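(* Let $(\varphi,(\lambda_i,Q_i)_{i\in\{1,\dots,\ell\}})$ be homogeneous PDMP characteristics on $\mathsf M$ with $\ell>1$. Assume that the characteristics $(\varphi,(\lambda_i,Q_i)_{i\in\{1,\dots,\ell-1\}})$ are non-explosive and that $\|\lambda_\ell\|_\infty<+\infty$. Then $(\varphi,(\lambda_i,Q_i)_{i\in\{1,\dots,\ell\}})$ are non-explosive as well.
   Context: $\mathsf M$ is a smooth closed Riemannian submanifold of $\mathbb R^N$ with Borel $\sigma$-field $\mathcal B(\mathsf M)$; $\infty\notin\mathsf M$ is a cemetery point; $\inf\emptyset=+\infty$; $\|\lambda\|_\infty=\sup_{x\in\mathsf M}|\lambda(x)|$. A homogeneous differential flow is a measurable map $(t,x)\mapsto\varphi_t(x)$ from $\mathbb R_+\times\mathsf M$ to $\mathsf M$ with $\varphi_0=\mathrm{Id}$, $\varphi_{t+s}=\varphi_s\circ\varphi_t$, $t\mapsto\varphi_t(x)$ continuously differentiable for all $x$, and each $\varphi_t$ a $C^1$-diffeomorphism of $\mathsf M$. A homogeneous jump rate is a measurable $\lambda:\mathsf M\to\mathbb R_+$ bounded on compact sets; a homogeneous Markov kernel is a Markov kernel on $(\mathsf M,\mathcal B(\mathsf M))$. Homogeneous characteristics $(\varphi,(\lambda_i,Q_i)_{i\in\{1,\dots,\ell\}})$ consist of such a flow, jump rates $\lambda_i$ and kernels $Q_i$. A PDMP with these characteristics and initial distribution $\mu_0$ is a process with the law of the following one. For each $i$ let $G_i:\mathsf M\times[0,1]\to\mathsf M$ be measurable with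 $Q_i(x,A)=\mathbb P(G_i(x,U)\in A)$, $U$ uniform on $[0,1]$. Let $W_0\sim\mu_0$ and, independently, let $((E_{j,k})_{j\in\{1,\dots,\ell\}},U_k)_{k\ge1}$ be i.i.d. in $k$, with $U_k$ uniform on $[0,1]$, $E_{j,k}$ exponential with parameter $1$, all independent. Set $S_0=0$, $X_0=X_0'=W_0$. Given $X'_k\in\mathsf M$, $S_k<\infty$, set $S_{j,k+1}=\inf\{t\ge S_k: E_{j,k+1}<\int_{S_k}^t\lambda_j(\varphi_{s-S_k}(X_k'))\,ds\}$ and $S_{k+1}=\min_jS_{j,k+1}$. If $S_{k+1}=+\infty$, set $S_m=+\infty$ for all $m>k$ and $X_t=\varphi_{t-S_k}(X_k')$ for all $t\ge S_k$. If $S_{k+1}<+\infty$, set $I_{k+1}=\min\{j:S_{j,k+1}=S_{k+1}\}$, $X'_{k+1}=G_{I_{k+1}}(\varphi_{S_{k+1}-S_k}(X'_k),U_{k+1})$, $X_t=\varphi_{t-S_k}(X'_k)$ for $t\in(S_k,S_{k+1})$ and $X_{S_{k+1}}=X'_{k+1}$. For $t\ge\sup_kS_k$, set $X_t=\infty$. The characteristics are non-explosive if, for every initial distribution, $\inf\{t\ge0:X_t=\infty\}=+\infty$ almost surely. *)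

theory Defs
  imports "HOL-Probability.Probability"
begin

section \<open>Smooth submanifolds of Euclidean space\<close>

text \<open>
  On an open set \<open>S\<close> of a Euclidean space this is the usual class \<open>C\<^sup>k\<close>: all directional
  derivatives of order at most \<open>k\<close> exist and are continuous.
\<close>

primrec Ck_on :: "nat \<Rightarrow> 'a::euclidean_space set \<Rightarrow> ('a \<Rightarrow> 'b::real_normed_vector) \<Rightarrow> bool" where
  "Ck_on 0 S f \<longleftrightarrow> continuous_on S f"
| "Ck_on (Suc k) S f \<longleftrightarrow>
     (\<forall>x\<in>S. f differentiable (at x)) \<and>
     (\<forall>v. Ck_on k S (\<lambda>x. frechet_derivative f (at x) v))"

definition smooth_on :: "'a::euclidean_space set \<Rightarrow> ('a \<Rightarrow> 'b::real_normed_vector) \<Rightarrow> bool" where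
  "smooth_on S f \<longleftrightarrow> (\<forall>k. Ck_on k S f)"

text \<open>
  Embedded submanifolds, described by slice charts. The Riemannian metric is the one induced
  by the ambient space, so it carries no additional data.
\<close>

definition smooth_submanifold :: "nat \<Rightarrow> 'a::euclidean_space set \<Rightarrow> bool" where
  "smooth_submanifold d M \<longleftrightarrow>
     (\<forall>p\<in>M. \<exists>U (V :: 'a set) T f g. open U \<and> p \<in> U \<and> open V \<and> homeomorphism U V f g \<and>
        smooth_on U f \<and> smooth_on V g \<and>
        subspace T \<and> dim T = d \<and> f ` (M \<inter> U) = T \<inter> V)"

text \<open>\<open>C\<^sup>1\<close> maps on a submanifold are those that locally extend to \<open>C\<^sup>1\<close> maps of the ambient space.\<close>

definition C1_map_on :: "'a::euclidean_space set \<Rightarrow> ('a \<Rightarrow> 'b::real_normed_vector) \<Rightarrow> bool" where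
  "C1_map_on M f \<longleftrightarrow>
     (\<forall>p\<in>M. \<exists>U F. open U \<and> p \<in> U \<and> Ck_on 1 U F \<and> (\<forall>x\<in>M \<inter> U. F x = f x))"

definition C1_diffeomorphism :: "'a::euclidean_space set \<Rightarrow> ('a \<Rightarrow> 'a) \<Rightarrow> bool" where
  "C1_diffeomorphism M f \<longleftrightarrow>
     bij_betw f M M \<and> C1_map_on M f \<and> C1_map_on M (inv_into M f)"

section \<open>Homogeneous characteristics\<close>

abbreviation borel_of :: "'a::euclidean_space set \<Rightarrow> 'a measure" where
  "borel_of M \<equiv> restrict_space borel M"

text \<open>Only the values of the flow, the rates and the kernels on \<open>M\<close> and at times \<open>t \<ge> 0\<close> matter.\<close>

definition differential_flow :: "'a::euclidean_space set \<Rightarrow> (real \<Rightarrow> 'a \<Rightarrow> 'a) \<Rightarrow> bool" where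
  "differential_flow M \<phi> \<longleftrightarrow>
     (\<lambda>(t, x). \<phi> t x) \<in> borel_of {0..} \<Otimes>\<^sub>M borel_of M \<rightarrow>\<^sub>M borel_of M \<and>
     (\<forall>x\<in>M. \<phi> 0 x = x) \<and>
     (\<forall>s\<ge>0. \<forall>t\<ge>0. \<forall>x\<in>M. \<phi> (t + s) x = \<phi> s (\<phi> t x)) \<and>
     (\<forall>x\<in>M. \<exists>D. continuous_on {0..} D \<and>
        (\<forall>t\<ge>0. ((\<lambda>t. \<phi> t x) has_vector_derivative D t) (at t within {0..}))) \<and>
     (\<forall>t\<ge>0. C1_diffeomorphism M (\<phi> t))"

definition jump_rate :: "'a::euclidean_space set \<Rightarrow> ('a \<Rightarrow> real) \<Rightarrow> bool" where
  "jump_rate M r \<longleftrightarrow>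
     r \<in> borel_of M \<rightarrow>\<^sub>M borel \<and> (\<forall>x\<in>M. 0 \<le> r x) \<and>
     (\<forall>K. compact K \<and> K \<subseteq> M \<longrightarrow> bounded (r ` K))"

definition markov_kernel :: "'a::euclidean_space set \<Rightarrow> ('a \<Rightarrow> 'a measure) \<Rightarrow> bool" where
  "markov_kernel M q \<longleftrightarrow> q \<in> borel_of M \<rightarrow>\<^sub>M prob_algebra (borel_of M)"

definition pdmp_characteristics ::
    "'a::euclidean_space set \<Rightarrow> nat \<Rightarrow> (real \<Rightarrow> 'a \<Rightarrow> 'a) \<Rightarrow> (nat \<Rightarrow> 'a \<Rightarrow> real) \<Rightarrow>
     (nat \<Rightarrow> 'a \<Rightarrow> 'a measure) \<Rightarrow> bool" where
  "pdmp_characteristics M l \<phi> r Q \<longleftrightarrow>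
     differential_flow M \<phi> \<and> (\<forall>i\<in>{1..l}. jump_rate M (r i) \<and> markov_kernel M (Q i))"

section \<open>The process\<close>

abbreviation uniform01 :: "real measure" where
  "uniform01 \<equiv> restrict_space lborel {0..1}"

definition represents_kernels ::
    "'a::euclidean_space set \<Rightarrow> nat \<Rightarrow> (nat \<Rightarrow> 'a \<Rightarrow> 'a measure) \<Rightarrow>
     (nat \<Rightarrow> 'a \<Rightarrow> real \<Rightarrow> 'a) \<Rightarrow> bool" where
  "represents_kernels M l Q G \<longleftrightarrow>
     (\<forall>i\<in>{1..l}.
        (\<lambda>(x, u). G i x u) \<in> borel_of M \<Otimes>\<^sub>M borel_of {0..1} \<rightarrow>\<^sub>M borel_of M \<and>
        (\<forall>x\<in>M. Q i x = distr uniform01 (borel_of M) (G i x)))"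

text \<open>
  The canonical space of \<open>W\<^sub>0\<close> and the driving variables. A point is a pair \<open>(w, n)\<close> where
  \<open>n k = (e, u)\<close> holds the exponential variables \<open>E\<^sub>j\<^sub>,\<^sub>k\<^sub>+\<^sub>1 = e j\<close> and the uniform variable
  \<open>U\<^sub>k\<^sub>+\<^sub>1 = u\<close> of the jump number \<open>k + 1\<close>.
\<close>

definition noise :: "nat \<Rightarrow> ((nat \<Rightarrow> real) \<times> real) measure" where
  "noise l = (\<Pi>\<^sub>M j\<in>{1..l}. density lborel (exponential_density 1)) \<Otimes>\<^sub>M uniform01"

definition driver ::
    "nat \<Rightarrow> 'a measure \<Rightarrow> ('a \<times> (nat \<Rightarrow> (nat \<Rightarrow> real) \<times> real)) measure" where
  "driver l \<mu> = \<mu> \<Otimes>\<^sub>M (\<Pi>\<^sub>M k\<in>UNIV. noise l)"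

definition jump_clock ::
    "(real \<Rightarrow> 'a \<Rightarrow> 'a) \<Rightarrow> ('a \<Rightarrow> real) \<Rightarrow> real \<Rightarrow> real \<Rightarrow> 'a \<Rightarrow> ereal" where
  "jump_clock \<phi> r e s x =
     Inf (ereal ` {t. s \<le> t \<and> e < (LINT v:{s..t}|lborel. r (\<phi> (v - s) x))})"

text \<open>
  The pairs \<open>(S\<^sub>k, X'\<^sub>k)\<close>. Once \<open>S\<^sub>k = \<infinity>\<close> the second component is a dummy.
\<close>

primrec skeleton ::
    "nat \<Rightarrow> (real \<Rightarrow> 'a \<Rightarrow> 'a) \<Rightarrow> (nat \<Rightarrow> 'a \<Rightarrow> real) \<Rightarrow> (nat \<Rightarrow> 'a \<Rightarrow> real \<Rightarrow> 'a) \<Rightarrow>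
     'a \<times> (nat \<Rightarrow> (nat \<Rightarrow> real) \<times> real) \<Rightarrow> nat \<Rightarrow> ereal \<times> 'a" where
  "skeleton l \<phi> r G \<omega> 0 = (0, fst \<omega>)"
| "skeleton l \<phi> r G \<omega> (Suc k) =
     (let (S, x) = skeleton l \<phi> r G \<omega> k;
          (e, u) = snd \<omega> k;
          s = real_of_ereal S;
          T = (\<lambda>j. jump_clock \<phi> (r j) (e j) s x);
          S' = Min (T ` {1..l});
          i = Min {j \<in> {1..l}. T j = S'}
      in if S = \<infinity> \<or> S' = \<infinity> then (\<infinity>, x)
         else (S', G i (\<phi> (real_of_ereal S' - s) x) u))"

text \<open>The cemetery point is \<open>None\<close>.\<close>

definition pdmp ::
    "nat \<Rightarrow> (real \<Rightarrow> 'a \<Rightarrow> 'a) \<Rightarrow> (nat \<Rightarrow> 'a \<Rightarrow> real) \<Rightarrow> (nat \<Rightarrow> 'a \<Rightarrow> real \<Rightarrow> 'a) \<Rightarrow>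
     real \<Rightarrow> 'a \<times> (nat \<Rightarrow> (nat \<Rightarrow> real) \<times> real) \<Rightarrow> 'a option" where
  "pdmp l \<phi> r G t \<omega> =
     (let S = (\<lambda>k. fst (skeleton l \<phi> r G \<omega> k));
          X' = (\<lambda>k. snd (skeleton l \<phi> r G \<omega> k))
      in if (SUP k. S k) \<le> ereal t then None
         else let k = (THE k. S k \<le> ereal t \<and> ereal t < S (Suc k))
              in Some (\<phi> (t - real_of_ereal (S k)) (X' k)))"

definition explosion_time :: "(real \<Rightarrow> 'a option) \<Rightarrow> ereal" where
  "explosion_time X = Inf (ereal ` {t. 0 \<le> t \<and> X t = None})"

text \<open>
  The law of the process does not depend on the choice of the functions \<open>G\<close> that represent the
  kernels; such functions exist on every closed \<open>M\<close>, since it is then a standard Borel space.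
\<close>

definition non_explosive ::
    "'a::euclidean_space set \<Rightarrow> nat \<Rightarrow> (real \<Rightarrow> 'a \<Rightarrow> 'a) \<Rightarrow> (nat \<Rightarrow> 'a \<Rightarrow> real) \<Rightarrow>
     (nat \<Rightarrow> 'a \<Rightarrow> 'a measure) \<Rightarrow> bool" where
  "non_explosive M l \<phi> r Q \<longleftrightarrow>
     (\<forall>\<mu> \<in> space (prob_algebra (borel_of M)). \<forall>G. represents_kernels M l Q G \<longrightarrow>
        (AE \<omega> in driver l \<mu>. explosion_time (\<lambda>t. pdmp l \<phi> r G t \<omega>) = \<infinity>))"

end

theory Submission
  imports Defs "HOL-Real_Asymp.Real_Asymp"
begin

text \<open>
  Let \<open>S\<^sub>k\<close>, \<open>X'\<^sub>k\<close> be the skeleton and \<open>K f x = E\<^sub>x[exp (- L S\<^sub>1) f(X'\<^sub>1)]\<close>, where \<open>L > 0\<close> bounds the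
  last rate. Since \<open>E\<^sub>x[exp (- L S\<^sub>k)] = (K\<^sup>k 1) x\<close>, non-explosion means that the limit \<open>w\<close> of
  \<open>K\<^sup>k 1\<close> vanishes, and \<open>w \<le> K w\<close>. Let \<open>K'\<close> be the operator of the process without the last
  jump mechanism. Conditionally on the first jump time \<open>s\<close> of that process, the last clock rings
  no earlier than an exponential time \<open>\<tau>\<close> of rate \<open>L\<close>, and
  \<open>E[exp (- L \<tau>); \<tau> < s] + exp (- L s) P(\<tau> \<ge> s) / 2 = 1/2\<close>. Hence \<open>w \<le> a\<close> and
  \<open>w \<le> g + a/2\<close> imply \<open>K w \<le> K' g + a/2\<close>; by induction \<open>w \<le> K'\<^sup>k 1 + a/2\<close> for all \<open>k\<close>, so
  \<open>w \<le> a/2\<close>. Starting from \<open>a = 1\<close> this gives \<open>w = 0\<close>.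
\<close>

section \<open>Jump clocks and the skeleton\<close>

text \<open>The substitution \<open>v \<mapsto> v - s\<close> removes the starting time, because
  neither rate nor flow depends on absolute time. Every step of the skeleton can thus be described
  by clocks started at 0.\<close>

lemma jump_clock_shift:
  "jump_clock \<phi> r e s x = ereal s + jump_clock \<phi> r e 0 x"
proof -
  have int: "(LINT v:{s..s + t}|lborel. r (\<phi> (v - s) x)) = (LINT v:{0..t}|lborel. r (\<phi> (v - 0) x))" for t
    unfolding set_lebesgue_integral_def
    by (subst lborel_integral_real_affine[where c=1 and t=s])
       (auto intro!: Bochner_Integration.integral_cong simp: indicator_def)
  let ?A = "{t. 0 \<le> t \<and> e < (LINT v:{0..t}|lborel. r (\<phi> (v - 0) x))}"
  have "{t. s \<le> t \<and> e < (LINT v:{s..t}|lborel. r (\<phi> (v - s) x))} = (+) s ` ?A"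
  proof (intro set_eqI iffI)
    fix t assume "t \<in> {t. s \<le> t \<and> e < (LINT v:{s..t}|lborel. r (\<phi> (v - s) x))}"
    then show "t \<in> (+) s ` ?A"
      using int[of "t - s"] by (intro image_eqI[of _ _ "t - s"]) auto
  qed (use int in auto)
  then have "jump_clock \<phi> r e s x = (INF t\<in>?A. ereal s + ereal t)"
    unfolding jump_clock_def by (simp add: image_image)
  also have "\<dots> = ereal s + (INF t\<in>?A. ereal t)"
  proof (cases "?A = {}")
    case True
    show ?thesis unfolding True by (simp add: top_ereal_def)
  next
    case False
    then show ?thesis by (rule INF_ereal_add_right) auto
  qed
  finally show ?thesis unfolding jump_clock_def by simp
qed

lemma jump_clock_nonneg: "0 \<le> jump_clock \<phi> r e 0 x"
  unfolding jump_clock_def by (auto intro!: Inf_greatest)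

definition clocks ::
    "(real \<Rightarrow> 'a \<Rightarrow> 'a) \<Rightarrow> (nat \<Rightarrow> 'a \<Rightarrow> real) \<Rightarrow> 'a \<Rightarrow> (nat \<Rightarrow> real) \<Rightarrow> nat \<Rightarrow> ereal" where
  "clocks \<phi> r x e j = jump_clock \<phi> (r j) (e j) 0 x"

definition first_time :: "nat \<Rightarrow> (nat \<Rightarrow> ereal) \<Rightarrow> ereal" where
  "first_time l T = Min (T ` {1..l})"

definition first_index :: "nat \<Rightarrow> (nat \<Rightarrow> ereal) \<Rightarrow> nat" where
  "first_index l T = Min {j. j \<in> {1..l} \<and> T j = first_time l T}"

text \<open>The value at \<open>t = \<infinity>\<close> is the dummy position that
  \<open>skeleton\<close> keeps when no further jump occurs.\<close>

definition landing ::
    "(real \<Rightarrow> 'a \<Rightarrow> 'a) \<Rightarrow> (nat \<Rightarrow> 'a \<Rightarrow> real \<Rightarrow> 'a) \<Rightarrow> 'a \<Rightarrow> real \<Rightarrow> ereal \<Rightarrow> nat \<Rightarrow> 'a" where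
  "landing \<phi> G x u t i = (if t = \<infinity> then x else G i (\<phi> (real_of_ereal t) x) u)"

lemma first_index_in:
  assumes "1 \<le> l"
  shows "first_index l T \<in> {1..l}" "T (first_index l T) = first_time l T"
proof -
  let ?J = "{j. j \<in> {1..l} \<and> T j = first_time l T}"
  have "first_time l T \<in> T ` {1..l}"
    unfolding first_time_def using assms by (intro Min_in) auto
  then have "?J \<noteq> {}" by auto
  then have "Min ?J \<in> ?J" by (intro Min_in) auto
  then show "first_index l T \<in> {1..l}" "T (first_index l T) = first_time l T"
    unfolding first_index_def by auto
qed

lemma first_time_Suc:
  assumes "1 \<le> m"
  shows "first_time (Suc m) T = min (T (Suc m)) (first_time m T)"
  using assms unfolding first_time_def by (simp add: atLeastAtMostSuc_conv Min_insert)

text \<open>Ties go to the smallest index, so an added last mechanism takes over the jump only if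
  its clock rings strictly first.\<close>

lemma first_index_Suc:
  assumes "1 \<le> m" "first_time m T \<le> T (Suc m)"
  shows "first_index (Suc m) T = first_index m T"
proof -
  let ?J = "{j. j \<in> {1..m} \<and> T j = first_time m T}"
  have eq: "first_time (Suc m) T = first_time m T"
    using assms by (simp add: first_time_Suc min_absorb2)
  have J: "first_index m T \<in> ?J" using first_index_in[OF assms(1), of T] by blast
  have "{j. j \<in> {1..Suc m} \<and> T j = first_time m T} = ?J \<or>
    {j. j \<in> {1..Suc m} \<and> T j = first_time m T} = insert (Suc m) ?J"
    by (auto simp: le_Suc_eq)
  moreover have "Min (insert (Suc m) ?J) = Min ?J"
  proof -
    have "Min (insert (Suc m) ?J) = min (Suc m) (Min ?J)"
      using J by (intro Min_insert) auto
    also have "Min ?J = first_index m T" by (simp only: first_index_def)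
    also have "min (Suc m) (first_index m T) = first_index m T"
      using J by (intro min_absorb2) auto
    also have "\<dots> = Min ?J" by (simp only: first_index_def)
    finally show ?thesis .
  qed
  ultimately show ?thesis unfolding first_index_def eq by (elim disjE) (simp_all only:)
qed

lemma first_time_nonneg: "1 \<le> l \<Longrightarrow> 0 \<le> first_time l (clocks \<phi> r x e)"
  unfolding first_time_def clocks_def by (subst Min_ge_iff) (auto simp: jump_clock_nonneg)

lemma skeleton_nonneg: "1 \<le> l \<Longrightarrow> 0 \<le> fst (skeleton l \<phi> r G \<omega> k)"
proof (induction k)
  case (Suc k)
  obtain S x where S: "skeleton l \<phi> r G \<omega> k = (S, x)" by fastforce
  obtain e u where e: "snd \<omega> k = (e, u)" by fastforce
  have "0 \<le> real_of_ereal S" using Suc S by (simp add: real_of_ereal_pos)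
  then have "0 \<le> Min ((\<lambda>j. jump_clock \<phi> (r j) (e j) (real_of_ereal S) x) ` {1..l})"
    using Suc.prems by (subst Min_ge_iff)
      (auto simp: jump_clock_shift[of _ _ _ "real_of_ereal S"] intro!: add_nonneg_nonneg jump_clock_nonneg)
  then show ?case
    by (simp add: S e Let_def)
qed simp

text \<open>By time homogeneity, the increment of a finite jump time depends only on the current
  position and on fresh noise. In this form the skeleton is visibly a Markov chain.\<close>

lemma skeleton_Suc:
  fixes \<omega> :: "'a \<times> (nat \<Rightarrow> (nat \<Rightarrow> real) \<times> real)"
  assumes "1 \<le> l"
  shows "skeleton l \<phi> r G \<omega> (Suc k) =
    (let (S, x) = skeleton l \<phi> r G \<omega> k; (e, u) = snd \<omega> k; T = clocks \<phi> r x e in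
     if S = \<infinity> then (\<infinity>, x)
     else (S + first_time l T, landing \<phi> G x u (first_time l T) (first_index l T)))"
proof -
  obtain S x where S: "skeleton l \<phi> r G \<omega> k = (S, x)" by fastforce
  obtain e u where e: "snd \<omega> k = (e, u)" by fastforce
  have S0: "0 \<le> S" using skeleton_nonneg[OF assms, of \<phi> r G \<omega> k] S by simp
  show ?thesis
  proof (cases "S = \<infinity>")
    case False
    then obtain s where s: "S = ereal s" using S0 by (cases S) auto
    define T where "T = clocks \<phi> r x e"
    define T' where "T' = (\<lambda>j. jump_clock \<phi> (r j) (e j) s x)"
    have T': "T' j = ereal s + T j" for j
      unfolding T'_def T_def clocks_def by (rule jump_clock_shift)
    \<comment> \<open>Adding the finite number \<open>s\<close> is monotone and cancellable, so it
      passes through the minimum and leaves the minimising indices unchanged.\<close>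
    have "Min (T' ` {1..l}) = Min ((\<lambda>t. ereal s + t) ` T ` {1..l})"
      by (simp add: T' image_image)
    also have "\<dots> = ereal s + first_time l T"
      unfolding first_time_def using assms
      by (subst mono_Min_commute[symmetric]) (auto intro!: monoI add_left_mono)
    finally have M: "Min (T' ` {1..l}) = ereal s + first_time l T" .
    have I: "Min {j \<in> {1..l}. T' j = ereal s + first_time l T} = first_index l T"
      unfolding first_index_def T' by (simp add: ereal_add_cancel_left)
    have T0: "0 \<le> first_time l T" unfolding T_def by (rule first_time_nonneg[OF assms])
    show ?thesis
      using T0 M I unfolding skeleton.simps S e landing_def
      by (cases "first_time l T") (auto simp: Let_def s T'_def T_def)
  qed (simp add: S e Let_def)
qed

lemma skeleton_mono:
  assumes "1 \<le> l"
  shows "fst (skeleton l \<phi> r G \<omega> k) \<le> fst (skeleton l \<phi> r G \<omega> (Suc k))"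
proof -
  obtain S x where S: "skeleton l \<phi> r G \<omega> k = (S, x)" by fastforce
  obtain e u where e: "snd \<omega> k = (e, u)" by fastforce
  have "S \<le> S + first_time l (clocks \<phi> r x e)"
    using add_left_mono[OF first_time_nonneg[OF assms], of S] by simp
  then show ?thesis
    unfolding skeleton_Suc[OF assms] by (simp add: S e Let_def)
qed

text \<open>The path is in the cemetery exactly from the supremum of the jump times on, and this
  supremum is nonnegative because \<open>S\<^sub>0 = 0\<close>.\<close>

lemma explosion_time_pdmp_eq_PInf:
  "explosion_time (\<lambda>t. pdmp l \<phi> r G t \<omega>) = \<infinity> \<longleftrightarrow> (SUP k. fst (skeleton l \<phi> r G \<omega> k)) = \<infinity>"
proof -
  define s where "s = (SUP k. fst (skeleton l \<phi> r G \<omega> k))"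
  have s0: "0 \<le> s" unfolding s_def by (rule SUP_upper2[of 0]) auto
  have "pdmp l \<phi> r G t \<omega> = None \<longleftrightarrow> s \<le> ereal t" for t
    unfolding pdmp_def s_def by (simp add: Let_def)
  then have "explosion_time (\<lambda>t. pdmp l \<phi> r G t \<omega>) = (INF t\<in>{t. 0 \<le> t \<and> s \<le> ereal t}. ereal t)"
    unfolding explosion_time_def by simp
  also have "\<dots> = \<infinity> \<longleftrightarrow> {t. 0 \<le> t \<and> s \<le> ereal t} = {}"
  proof
    assume inf: "(INF t\<in>{t. 0 \<le> t \<and> s \<le> ereal t}. ereal t) = \<infinity>"
    have "(INF t\<in>{t. 0 \<le> t \<and> s \<le> ereal t}. ereal t) \<le> ereal t" if "0 \<le> t" "s \<le> ereal t" for t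
      using that by (intro INF_lower) auto
    then show "{t. 0 \<le> t \<and> s \<le> ereal t} = {}" unfolding inf by auto
  qed (simp only: image_empty Inf_empty top_ereal_def)
  also have "\<dots> \<longleftrightarrow> s = \<infinity>"
    using s0 by (cases s) (auto intro: exI[of _ "real_of_ereal s"])
  finally show ?thesis unfolding s_def .
qed

section \<open>Measurability of one step\<close>

lemma prob_space_exponential1: "prob_space (density lborel (exponential_density 1))"
  by (rule prob_space_exponential_density) simp

lemma prob_space_uniform01: "prob_space uniform01"
  by (intro prob_spaceI) (simp add: space_restrict_space emeasure_restrict_space)

lemma prob_space_noise: "prob_space (noise l)"
proof -
  interpret E: prob_space "\<Pi>\<^sub>M j\<in>{1..l}. density lborel (exponential_density 1)"
    by (intro prob_space_PiM prob_space_exponential1)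
  interpret U: prob_space uniform01 by (rule prob_space_uniform01)
  interpret pair_prob_space "\<Pi>\<^sub>M j\<in>{1..l}. density lborel (exponential_density 1)" uniform01 ..
  show ?thesis unfolding noise_def by (rule prob_space_axioms)
qed

lemma sets_noise [measurable_cong]:
  "sets (noise l) = sets ((\<Pi>\<^sub>M j\<in>{1..l}. borel) \<Otimes>\<^sub>M borel_of {0..1})"
  unfolding noise_def
  by (intro sets_pair_measure_cong sets_PiM_cong sets_restrict_space_cong) auto

section \<open>Flow, rates and a single jump as measurable functions\<close>

locale pdmp_model =
  fixes M :: "'a::euclidean_space set" and l :: nat and \<phi> :: "real \<Rightarrow> 'a \<Rightarrow> 'a"
    and r :: "nat \<Rightarrow> 'a \<Rightarrow> real" and Q :: "nat \<Rightarrow> 'a \<Rightarrow> 'a measure"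
    and G :: "nat \<Rightarrow> 'a \<Rightarrow> real \<Rightarrow> 'a"
  assumes one_le_l: "1 \<le> l"
    and characteristics: "pdmp_characteristics M l \<phi> r Q"
    and represents: "represents_kernels M l Q G"
begin

lemma space_borel_of [simp]: "space (borel_of M) = M"
  by (simp add: space_restrict_space)

lemma flow_measurable: "(\<lambda>(t, x). \<phi> t x) \<in> borel_of {0..} \<Otimes>\<^sub>M borel_of M \<rightarrow>\<^sub>M borel_of M"
  using characteristics by (simp add: pdmp_characteristics_def differential_flow_def)

lemma flow_measurable':
  assumes "f \<in> N \<rightarrow>\<^sub>M borel" and "g \<in> N \<rightarrow>\<^sub>M borel_of M"
    and "\<And>x. x \<in> space N \<Longrightarrow> (0::real) \<le> f x"
  shows "(\<lambda>x. \<phi> (f x) (g x)) \<in> N \<rightarrow>\<^sub>M borel_of M"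
proof -
  have "f \<in> N \<rightarrow>\<^sub>M borel_of {0..}"
    using assms by (intro measurable_restrict_space2) auto
  then have "(\<lambda>x. (f x, g x)) \<in> N \<rightarrow>\<^sub>M borel_of {0..} \<Otimes>\<^sub>M borel_of M"
    using assms by simp
  from measurable_compose[OF this flow_measurable] show ?thesis by simp
qed

lemma flow_in: "0 \<le> t \<Longrightarrow> x \<in> M \<Longrightarrow> \<phi> t x \<in> M"
  using measurable_space[OF flow_measurable, of "(t, x)"]
  by (simp add: space_pair_measure space_restrict_space)

lemma rate_measurable [measurable]: "j \<in> {1..l} \<Longrightarrow> r j \<in> borel_of M \<rightarrow>\<^sub>M borel"
  using characteristics by (simp add: pdmp_characteristics_def jump_rate_def)

lemma rate_nonneg: "j \<in> {1..l} \<Longrightarrow> x \<in> M \<Longrightarrow> 0 \<le> r j x"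
  using characteristics by (simp add: pdmp_characteristics_def jump_rate_def)

text \<open>The path is differentiable, hence continuous, so its piece over \<open>{0..t}\<close> is
  a compact subset of \<open>M\<close>, where the rate is bounded.\<close>

lemma rate_bounded_along_flow:
  assumes j: "j \<in> {1..l}" and x: "x \<in> M"
  shows "\<exists>B. \<forall>v\<in>{0..t}. \<bar>r j (\<phi> v x)\<bar> \<le> B"
proof -
  obtain D where D: "\<And>t. 0 \<le> t \<Longrightarrow> ((\<lambda>t. \<phi> t x) has_vector_derivative D t) (at t within {0..})"
    using characteristics x unfolding pdmp_characteristics_def differential_flow_def by blast
  have "continuous_on {0..} (\<lambda>t. \<phi> t x)"
    by (rule continuous_on_vector_derivative[of _ _ D]) (use D in auto)
  then have "continuous_on {0..t} (\<lambda>t. \<phi> t x)"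
    by (rule continuous_on_subset) auto
  then have "compact ((\<lambda>v. \<phi> v x) ` {0..t})"
    by (rule compact_continuous_image) simp
  moreover have "(\<lambda>v. \<phi> v x) ` {0..t} \<subseteq> M" using flow_in x by auto
  ultimately have "bounded (r j ` (\<lambda>v. \<phi> v x) ` {0..t})"
    using characteristics j by (simp add: pdmp_characteristics_def jump_rate_def)
  then show ?thesis unfolding bounded_iff by auto
qed

text \<open>The rate accumulated along the flow; clock \<open>j\<close> rings once it exceeds the
  exponential variable.\<close>

definition hazard :: "nat \<Rightarrow> real \<Rightarrow> 'a \<Rightarrow> real" where
  "hazard j t x = (LINT v:{0..t}|lborel. r j (\<phi> v x))"

text \<open>The flow is controlled only at nonnegative times. Replacing \<open>v\<close> by
  \<open>max 0 v\<close> changes nothing on \<open>{0..t}\<close> and makes the integrand measurable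
  on the whole line.\<close>

lemma hazard_eq: "hazard j t x = (LINT v:{0..t}|lborel. r j (\<phi> (max 0 v) x))"
  unfolding hazard_def set_lebesgue_integral_def
  by (intro Bochner_Integration.integral_cong) (auto simp: indicator_def)

lemma rate_flow_measurable:
  "j \<in> {1..l} \<Longrightarrow> (\<lambda>(x, v). r j (\<phi> (max 0 v) x)) \<in> borel_of M \<Otimes>\<^sub>M borel \<rightarrow>\<^sub>M borel"
  unfolding case_prod_beta
  by (intro measurable_compose[OF flow_measurable' rate_measurable]) auto

lemma hazard_measurable [measurable]:
  assumes "j \<in> {1..l}"
  shows "hazard j t \<in> borel_of M \<rightarrow>\<^sub>M borel"
proof -
  have [measurable]: "(\<lambda>p. r j (\<phi> (max 0 (snd p)) (fst p))) \<in> borel_of M \<Otimes>\<^sub>M borel \<rightarrow>\<^sub>M borel"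
    using rate_flow_measurable[OF assms] by (simp add: case_prod_beta)
  show ?thesis
    unfolding hazard_eq set_lebesgue_integral_def by measurable
qed

text \<open>A bounded function on a set of finite measure. Without integrability the Bochner
  integral would fall back to 0, and the hazard could fail to be monotone in
  \<open>t\<close>.\<close>

lemma hazard_integrable:
  assumes j: "j \<in> {1..l}" and x: "x \<in> M"
  shows "set_integrable lborel {0..t} (\<lambda>v. r j (\<phi> v x))"
proof -
  obtain B where B: "\<And>v. v \<in> {0..t} \<Longrightarrow> \<bar>r j (\<phi> v x)\<bar> \<le> B"
    using rate_bounded_along_flow[OF j x] by blast
  have "(\<lambda>v. r j (\<phi> (max 0 v) x)) \<in> borel \<rightarrow>\<^sub>M borel"
    by (intro measurable_compose[OF flow_measurable' rate_measurable] j) (use x in auto)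
  then have "integrable lborel (\<lambda>v. indicator {0..t} v *\<^sub>R r j (\<phi> (max 0 v) x))"
    by (intro integrableI_bounded_set_indicator[where B=B]) (auto intro!: AE_I2 B simp: emeasure_lborel_Icc_eq)
  then show ?thesis unfolding set_integrable_def
    by (rule Bochner_Integration.integrable_cong[THEN iffD1, rotated -1]) (auto simp: indicator_def)
qed

lemma hazard_mono:
  assumes j: "j \<in> {1..l}" and x: "x \<in> M" and "s \<le> t"
  shows "hazard j s x \<le> hazard j t x"
  unfolding hazard_def set_lebesgue_integral_def
  using hazard_integrable[OF j x] assms rate_nonneg[OF j] flow_in[OF _ x]
  by (intro Bochner_Integration.integral_mono) (auto simp: set_integrable_def indicator_def)

lemma hazard_le:
  assumes j: "j \<in> {1..l}" and x: "x \<in> M" and "0 \<le> t" and L: "\<And>y. y \<in> M \<Longrightarrow> r j y \<le> L"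
  shows "hazard j t x \<le> L * t"
proof -
  have "hazard j t x \<le> (LINT v:{0..t}|lborel. L)"
    unfolding hazard_def using hazard_integrable[OF j x] L flow_in[OF _ x]
    by (intro set_integral_mono borel_integrable_atLeastAtMost'[of 0 t "\<lambda>_. L"]) auto
  also have "\<dots> = L * t" using \<open>0 \<le> t\<close> by (simp add: set_lebesgue_integral_def)
  finally show ?thesis .
qed

lemma jump_clock_eq_hazard:
  "jump_clock \<phi> (r j) e 0 x = (INF t\<in>{t. 0 \<le> t \<and> e < hazard j t x}. ereal t)"
  by (simp add: jump_clock_def hazard_def)

text \<open>The hazard grows at most at speed \<open>L\<close>, so it cannot exceed \<open>e\<close>
  before time \<open>e / L\<close>. For an exponential variable \<open>e\<close> of parameter 1,
  \<open>e / L\<close> is the exponential time of rate \<open>L\<close> used in the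
  comparison.\<close>

lemma jump_clock_ge:
  assumes "j \<in> {1..l}" "x \<in> M" "0 < L" "\<And>y. y \<in> M \<Longrightarrow> r j y \<le> L"
  shows "ereal (e / L) \<le> jump_clock \<phi> (r j) e 0 x"
  unfolding jump_clock_eq_hazard
proof (rule INF_greatest)
  fix t assume "t \<in> {t. 0 \<le> t \<and> e < hazard j t x}"
  then have "e < L * t" using hazard_le[of j x t L] assms by fastforce
  then show "ereal (e / L) \<le> ereal t" using \<open>0 < L\<close> by (simp add: field_simps)
qed

text \<open>Monotonicity of the hazard lets the infimum range over rational times only.\<close>

lemma jump_clock_eq_rat:
  assumes "j \<in> {1..l}" "x \<in> M"
  shows "jump_clock \<phi> (r j) e 0 x =
    (INF q\<in>{q\<in>\<rat>. 0 \<le> q}. if e < hazard j q x then ereal q else \<infinity>)"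
  unfolding jump_clock_eq_hazard
proof (rule antisym)
  show "(INF t\<in>{t. 0 \<le> t \<and> e < hazard j t x}. ereal t) \<le>
    (INF q\<in>{q\<in>\<rat>. 0 \<le> q}. if e < hazard j q x then ereal q else \<infinity>)"
    by (rule INF_greatest) (auto intro: INF_lower)
  show "(INF q\<in>{q\<in>\<rat>. 0 \<le> q}. if e < hazard j q x then ereal q else \<infinity>) \<le>
    (INF t\<in>{t. 0 \<le> t \<and> e < hazard j t x}. ereal t)"
  proof (rule INF_greatest, rule dense_ge)
    fix t z assume t: "t \<in> {t. 0 \<le> t \<and> e < hazard j t x}" and z: "ereal t < z"
    \<comment> \<open>The time \<open>t\<close> may be irrational; a rational \<open>q\<close> just
      after it, and at most \<open>z\<close>, still satisfies the constraint because the hazard is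
      monotone.\<close>
    obtain q where q: "q \<in> \<rat>" "t < q" "ereal q \<le> z"
    proof (cases z)
      case (real y)
      then show ?thesis using Rats_dense_in_real[of t y] z that by force
    next
      case PInf
      then show ?thesis using Rats_dense_in_real[of t "t + 1"] that by force
    qed (use z in auto)
    have "e < hazard j q x" using t q hazard_mono[OF assms, of t q] by auto
    then show "(INF q\<in>{q\<in>\<rat>. 0 \<le> q}. if e < hazard j q x then ereal q else \<infinity>) \<le> z"
      using t q by (intro INF_lower2[of q]) auto
  qed
qed

lemma jump_clock_measurable:
  assumes "j \<in> {1..l}"
  shows "(\<lambda>p. jump_clock \<phi> (r j) (snd p) 0 (fst p)) \<in> borel_of M \<Otimes>\<^sub>M borel \<rightarrow>\<^sub>M borel"
proof -
  note [measurable] = hazard_measurable[OF assms]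
  have "countable {q\<in>\<rat>. 0 \<le> (q::real)}" by (rule countable_subset[OF _ countable_rat]) auto
  then have "(\<lambda>p. INF q\<in>{q\<in>\<rat>. 0 \<le> q}. if snd p < hazard j q (fst p) then ereal q else \<infinity>)
      \<in> borel_of M \<Otimes>\<^sub>M borel \<rightarrow>\<^sub>M borel"
    by measurable
  then show ?thesis
    by (rule measurable_cong[THEN iffD2, rotated])
       (auto simp: jump_clock_eq_rat[OF assms] space_pair_measure)
qed

lemma clocks_measurable:
  assumes j: "j \<in> {1..l}"
  shows "(\<lambda>p. clocks \<phi> r (fst p) (fst (snd p)) j) \<in> borel_of M \<Otimes>\<^sub>M noise l \<rightarrow>\<^sub>M borel"
proof -
  have "(\<lambda>p. (fst p, fst (snd p) j)) \<in> borel_of M \<Otimes>\<^sub>M noise l \<rightarrow>\<^sub>M borel_of M \<Otimes>\<^sub>M borel"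
    using j by measurable
  from measurable_compose[OF this jump_clock_measurable[OF j]]
  show ?thesis unfolding clocks_def by simp
qed

definition wait :: "'a \<Rightarrow> (nat \<Rightarrow> real) \<times> real \<Rightarrow> ereal" where
  "wait x n = first_time l (clocks \<phi> r x (fst n))"

definition target :: "'a \<Rightarrow> (nat \<Rightarrow> real) \<times> real \<Rightarrow> 'a" where
  "target x n = landing \<phi> G x (snd n) (wait x n) (first_index l (clocks \<phi> r x (fst n)))"

lemma wait_nonneg: "0 \<le> wait x n"
  unfolding wait_def by (rule first_time_nonneg[OF one_le_l])

lemma wait_measurable:
  "(\<lambda>p. wait (fst p) (snd p)) \<in> borel_of M \<Otimes>\<^sub>M noise l \<rightarrow>\<^sub>M borel"
  unfolding wait_def first_time_def by (intro borel_measurable_Min clocks_measurable) auto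

text \<open>The index of the winning clock takes finitely many values, and for each fixed index the
  landing point is measurable, so the two can be composed.\<close>

lemma target_measurable:
  "(\<lambda>p. target (fst p) (snd p)) \<in> borel_of M \<Otimes>\<^sub>M noise l \<rightarrow>\<^sub>M borel_of M"
proof -
  let ?N = "borel_of M \<Otimes>\<^sub>M noise l"
  note [measurable] = wait_measurable
  define I where "I p = first_index l (clocks \<phi> r (fst p) (fst (snd p)))" for p :: "'a \<times> (nat \<Rightarrow> real) \<times> real"
  have "I \<in> ?N \<rightarrow>\<^sub>M count_space UNIV"
  proof -
    have "Measurable.pred ?N (\<lambda>p. j \<in> {1..l} \<and> clocks \<phi> r (fst p) (fst (snd p)) j = wait (fst p) (snd p))" for j
    proof (cases "j \<in> {1..l}")
      case True
      note [measurable] = clocks_measurable[OF True]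
      show ?thesis by measurable
    next
      \<comment> \<open>Nothing is known about clocks outside \<open>{1..l}\<close>, but there the
        predicate is constantly false.\<close>
      case False
      then have "(\<lambda>p. j \<in> {1..l} \<and> clocks \<phi> r (fst p) (fst (snd p)) j = wait (fst p) (snd p)) = (\<lambda>_. False)"
        by (intro ext) blast
      then show ?thesis by (simp only: measurable_const space_count_space UNIV_I)
    qed
    then have "(\<lambda>p. Min {j. j \<in> {1..l} \<and> clocks \<phi> r (fst p) (fst (snd p)) j = wait (fst p) (snd p)})
        \<in> ?N \<rightarrow>\<^sub>M count_space UNIV"
      by (rule measurable_Min_nat)
    then show ?thesis
      by (simp only: I_def[abs_def] first_index_def wait_def)
  qed
  then have I: "I \<in> ?N \<rightarrow>\<^sub>M count_space {1..l}"
    using first_index_in(1)[OF one_le_l] by (auto simp: measurable_count_space_eq2 measurable_def I_def)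
  have "(\<lambda>p. landing \<phi> G (fst p) (snd (snd p)) (wait (fst p) (snd p)) i) \<in> ?N \<rightarrow>\<^sub>M borel_of M"
    if i: "i \<in> {1..l}" for i
  proof -
    have [measurable]: "(\<lambda>(x, u). G i x u) \<in> borel_of M \<Otimes>\<^sub>M borel_of {0..1} \<rightarrow>\<^sub>M borel_of M"
      using represents i by (simp add: represents_kernels_def)
    have [measurable]: "(\<lambda>p. \<phi> (real_of_ereal (wait (fst p) (snd p))) (fst p)) \<in> ?N \<rightarrow>\<^sub>M borel_of M"
      by (intro flow_measurable') (auto simp: wait_nonneg real_of_ereal_pos)
    have "(\<lambda>p. (\<lambda>(x, u). G i x u) (\<phi> (real_of_ereal (wait (fst p) (snd p))) (fst p), snd (snd p))) \<in> ?N \<rightarrow>\<^sub>M borel_of M"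
      by measurable
    then show ?thesis unfolding landing_def by simp
  qed
  from measurable_compose_countable'[OF this I] show ?thesis
    unfolding target_def I_def by simp
qed

end

section \<open>The discounted transition operator\<close>

text \<open>The value at \<open>\<infinity>\<close> is set separately because
  \<open>real_of_ereal \<infinity> = 0\<close> would give 1 instead of the limit 0 that the
  exponential has for \<open>L > 0\<close>.\<close>

definition discount :: "real \<Rightarrow> ereal \<Rightarrow> ennreal" where
  "discount L S = (if S = \<infinity> then 0 else ennreal (exp (- L * real_of_ereal S)))"

lemma discount_simps [simp]:
  "discount L \<infinity> = 0" "discount L (ereal s) = ennreal (exp (- L * s))" "discount L 0 = 1"
  by (auto simp: discount_def)

lemma discount_measurable [measurable]: "discount L \<in> borel \<rightarrow>\<^sub>M borel"
  unfolding discount_def[abs_def] by measurable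

lemma discount_add:
  assumes "0 \<le> S" "0 \<le> T"
  shows "discount L (S + T) = discount L S * discount L T"
  using assms
  by (cases S; cases T) (auto simp: algebra_simps exp_add ennreal_mult[symmetric] exp_minus exp_diff field_simps)

lemma discount_antimono:
  assumes "0 \<le> L" "0 \<le> S" "S \<le> T"
  shows "discount L T \<le> discount L S"
  using assms by (cases S; cases T) (auto intro!: ennreal_leI mult_left_mono)

lemma discount_le_one: "0 \<le> L \<Longrightarrow> 0 \<le> S \<Longrightarrow> discount L S \<le> 1"
  using discount_antimono[of L 0 S] by simp

text \<open>The discount is positive at finite times and decreases to 0. Divergence of the jump
  times thus becomes the vanishing of a bounded quantity that can be integrated.\<close>

lemma INF_discount_eq_0_iff:
  assumes "0 < L" and S: "\<And>k. 0 \<le> S k"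
  shows "(INF k. discount L (S k)) = 0 \<longleftrightarrow> (SUP k::nat. S k) = \<infinity>"
proof
  assume inf: "(INF k. discount L (S k)) = 0"
  have "\<exists>k\<in>UNIV. ereal (real n) \<le> S k" for n
  proof -
    have "(INF k. discount L (S k)) < ennreal (exp (- L * real n))" unfolding inf by simp
    then obtain k where k: "discount L (S k) < discount L (ereal (real n))"
      by (auto simp: INF_less_iff)
    have "ereal (real n) \<le> S k"
      using k discount_antimono[of L "S k" "ereal (real n)"] S[of k] \<open>0 < L\<close>
      by (meson less_eq_real_def linorder_le_cases not_le)
    then show ?thesis by blast
  qed
  then show "(SUP k. S k) = \<infinity>" by (rule SUP_PInfty)
next
  assume sup: "(SUP k. S k) = \<infinity>"
  have "(INF k. discount L (S k)) \<le> e" if "0 < e" for e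
  proof (cases e)
    case (real c)
    then have c: "0 < c" using that by simp
    \<comment> \<open>\<open>- ln c / L\<close> is the time at which the discount equals
      \<open>c\<close>.\<close>
    have "ereal (- ln c / L) < (SUP k. S k)" unfolding sup by simp
    then obtain k where k: "ereal (- ln c / L) < S k" by (auto simp: less_SUP_iff)
    have "discount L (S k) \<le> e"
    proof (cases "S k")
      case (real s)
      then have "- L * s < ln c" using k \<open>0 < L\<close> by (simp add: field_simps)
      then have "exp (- L * s) < exp (ln c)" by simp
      then show ?thesis using real \<open>e = ennreal c\<close> c by (simp add: ennreal_leI)
    qed (use k in auto)
    then show ?thesis by (intro INF_lower2[of k]) auto
  qed simp
  then have "(INF k. discount L (S k)) \<le> 0" by (rule dense_ge)
  then show "(INF k. discount L (S k)) = 0" by simp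
qed

text \<open>Multiplication by a finite constant is continuous and monotone. For
  \<open>c = \<top>\<close> the equation fails when positive values decrease to 0.\<close>

lemma INF_ennreal_cmult:
  fixes f :: "nat \<Rightarrow> ennreal"
  assumes "c < \<top>"
  shows "(INF k. c * f k) = c * (INF k. f k)"
proof -
  have "continuous_on UNIV (\<lambda>x. c * x)"
    using assms by (intro ennreal_continuous_on_cmult continuous_on_id)
  then have "continuous (at_right (INF k. f k)) (\<lambda>x. c * x)"
    by (meson UNIV_I continuous_on_eq_continuous_within continuous_within_subset subset_UNIV)
  then have "c * Inf (range f) = Inf ((*) c ` range f)"
    by (intro continuous_at_Inf_mono) (simp_all add: mono_def mult_left_mono)
  then show ?thesis by (simp add: image_image)
qed

text \<open>Coordinate \<open>k\<close> is independent of the earlier ones, the only ones that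
  \<open>h\<close> sees in its first argument. Splicing the first \<open>k\<close> coordinates of
  one sequence with a second, independent sequence preserves the product measure.\<close>

lemma (in sequence_space) nn_integral_fresh_coordinate:
  assumes h[measurable]: "h \<in> S \<Otimes>\<^sub>M M \<rightarrow>\<^sub>M borel"
    and past: "\<And>\<omega> \<omega>' a. (\<And>i. i < k \<Longrightarrow> \<omega> i = \<omega>' i) \<Longrightarrow> h (\<omega>, a) = h (\<omega>', a)"
  shows "(\<integral>\<^sup>+\<omega>. h (\<omega>, \<omega> k) \<partial>S) = (\<integral>\<^sup>+\<omega>. \<integral>\<^sup>+a. h (\<omega>, a) \<partial>M \<partial>S)"
proof -
  have "(\<integral>\<^sup>+\<omega>. h (\<omega>, \<omega> k) \<partial>S) =
      (\<integral>\<^sup>+\<omega>. h (\<omega>, \<omega> k) \<partial>distr (S \<Otimes>\<^sub>M S) S (\<lambda>(\<omega>, \<omega>'). comb_seq k \<omega> \<omega>'))"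
    by (simp only: PiM_comb_seq)
  also have "\<dots> = (\<integral>\<^sup>+p. h (comb_seq k (fst p) (snd p), comb_seq k (fst p) (snd p) k) \<partial>(S \<Otimes>\<^sub>M S))"
    by (subst nn_integral_distr) (auto simp: case_prod_beta)
  also have "\<dots> = (\<integral>\<^sup>+p. h (fst p, snd p 0) \<partial>(S \<Otimes>\<^sub>M S))"
  proof (intro nn_integral_cong)
    \<comment> \<open>Position \<open>k\<close> of the spliced sequence is position 0 of the second
      sequence; the earlier positions come from the first.\<close>
    fix p :: "(nat \<Rightarrow> 'a) \<times> (nat \<Rightarrow> 'a)"
    have "comb_seq k (fst p) (snd p) k = snd p 0" by (simp add: comb_seq_def)
    then show "h (comb_seq k (fst p) (snd p), comb_seq k (fst p) (snd p) k) = h (fst p, snd p 0)"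
      using past[of "comb_seq k (fst p) (snd p)" "fst p" "snd p 0"] by (simp add: comb_seq_less)
  qed
  also have "\<dots> = (\<integral>\<^sup>+\<omega>. \<integral>\<^sup>+\<omega>'. h (\<omega>, \<omega>' 0) \<partial>S \<partial>S)"
    by (subst P.nn_integral_fst[symmetric]) auto
  also have "\<dots> = (\<integral>\<^sup>+\<omega>. \<integral>\<^sup>+a. h (\<omega>, a) \<partial>M \<partial>S)"
  proof (intro nn_integral_cong)
    fix \<omega> assume \<omega>: "\<omega> \<in> space S"
    have "(\<integral>\<^sup>+a. h (\<omega>, a) \<partial>M) = (\<integral>\<^sup>+a. h (\<omega>, a) \<partial>distr S M (\<lambda>\<omega>'. \<omega>' 0))"
      by (simp add: PiM_component)
    also have "\<dots> = (\<integral>\<^sup>+\<omega>'. h (\<omega>, \<omega>' 0) \<partial>S)"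
      using \<omega> by (subst nn_integral_distr) auto
    finally show "(\<integral>\<^sup>+\<omega>'. h (\<omega>, \<omega>' 0) \<partial>S) = (\<integral>\<^sup>+a. h (\<omega>, a) \<partial>M)" by simp
  qed
  finally show ?thesis .
qed

section \<open>Iterates of the operator and the law of the skeleton\<close>

context pdmp_model
begin

abbreviation drives :: "(nat \<Rightarrow> (nat \<Rightarrow> real) \<times> real) measure" where
  "drives \<equiv> \<Pi>\<^sub>M k\<in>UNIV. noise l"

abbreviation jump_time :: "nat \<Rightarrow> 'a \<times> (nat \<Rightarrow> (nat \<Rightarrow> real) \<times> real) \<Rightarrow> ereal" where
  "jump_time k \<omega> \<equiv> fst (skeleton l \<phi> r G \<omega> k)"

abbreviation jump_place :: "nat \<Rightarrow> 'a \<times> (nat \<Rightarrow> (nat \<Rightarrow> real) \<times> real) \<Rightarrow> 'a" where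
  "jump_place k \<omega> \<equiv> snd (skeleton l \<phi> r G \<omega> k)"

lemma sequence_space_noise: "sequence_space (noise l)"
proof -
  interpret prob_space "noise l" by (rule prob_space_noise)
  show ?thesis by unfold_locales
qed

lemma jump_time_Suc:
  "jump_time (Suc k) \<omega> = jump_time k \<omega> + wait (jump_place k \<omega>) (snd \<omega> k)"
  using wait_nonneg unfolding skeleton_Suc[OF one_le_l] wait_def
  by (auto simp: Let_def split: prod.splits)

lemma jump_place_Suc:
  "jump_place (Suc k) \<omega> =
    (if jump_time k \<omega> = \<infinity> then jump_place k \<omega> else target (jump_place k \<omega>) (snd \<omega> k))"
  unfolding skeleton_Suc[OF one_le_l] target_def wait_def
  by (auto simp: Let_def split: prod.splits)

lemma skeleton_past:
  assumes "\<And>i. i < k \<Longrightarrow> n i = n' i"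
  shows "skeleton l \<phi> r G (x, n) k = skeleton l \<phi> r G (x, n') k"
  using assms
proof (induction k)
  case (Suc k)
  then have "skeleton l \<phi> r G (x, n) k = skeleton l \<phi> r G (x, n') k" "n k = n' k" by auto
  then show ?case unfolding skeleton_Suc[OF one_le_l] by simp
qed simp

lemma skeleton_measurable:
  "jump_time k \<in> borel_of M \<Otimes>\<^sub>M drives \<rightarrow>\<^sub>M borel"
  "jump_place k \<in> borel_of M \<Otimes>\<^sub>M drives \<rightarrow>\<^sub>M borel_of M"
proof (induction k)
  case (Suc k)
  note [measurable] = Suc.IH
  have *: "(\<lambda>\<omega>. (jump_place k \<omega>, snd \<omega> k)) \<in> borel_of M \<Otimes>\<^sub>M drives \<rightarrow>\<^sub>M borel_of M \<Otimes>\<^sub>M noise l"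
    by measurable
  note [measurable] = measurable_compose[OF * wait_measurable, simplified]
    measurable_compose[OF * target_measurable, simplified]
  case 1 show ?case unfolding jump_time_Suc by measurable
  case 2 show ?case unfolding jump_place_Suc by measurable
qed simp_all

text \<open>On \<open>wait x n = \<infinity>\<close> the discount is 0, so the dummy target
  contributes nothing.\<close>

definition K :: "real \<Rightarrow> ('a \<Rightarrow> ennreal) \<Rightarrow> 'a \<Rightarrow> ennreal" where
  "K L f x = (\<integral>\<^sup>+n. discount L (wait x n) * f (target x n) \<partial>noise l)"

lemma K_integrand_measurable:
  assumes f: "f \<in> borel_of M \<rightarrow>\<^sub>M borel"
  shows "(\<lambda>p. discount L (wait (fst p) (snd p)) * f (target (fst p) (snd p))) \<in> borel_of M \<Otimes>\<^sub>M noise l \<rightarrow>\<^sub>M borel"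
  using wait_measurable measurable_compose[OF target_measurable f] by measurable

lemma K_measurable:
  assumes f: "f \<in> borel_of M \<rightarrow>\<^sub>M borel"
  shows "K L f \<in> borel_of M \<rightarrow>\<^sub>M borel"
proof -
  interpret prob_space "noise l" by (rule prob_space_noise)
  show ?thesis unfolding K_def[abs_def]
    by (rule borel_measurable_nn_integral) (use K_integrand_measurable[OF f] in \<open>simp add: case_prod_beta\<close>)
qed

lemma K_funpow_measurable:
  "f \<in> borel_of M \<rightarrow>\<^sub>M borel \<Longrightarrow> (K L ^^ k) f \<in> borel_of M \<rightarrow>\<^sub>M borel"
  by (induction k) (auto intro: K_measurable)

lemma measurable_K_integrand:
  assumes "f \<in> borel_of M \<rightarrow>\<^sub>M borel" "x \<in> M"
  shows "(\<lambda>n. discount L (wait x n) * f (target x n)) \<in> noise l \<rightarrow>\<^sub>M borel"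
  using measurable_compose[OF measurable_Pair1' K_integrand_measurable[OF assms(1)], of x] assms(2) by simp

text \<open>This is the Markov property. The last step is integrated out first, which turns
  \<open>f\<close> into \<open>K L f\<close>; hence the induction lets \<open>f\<close>
  vary.\<close>

lemma nn_integral_skeleton:
  assumes x: "x \<in> M" and f: "f \<in> borel_of M \<rightarrow>\<^sub>M borel"
  shows "(\<integral>\<^sup>+n. discount L (jump_time k (x, n)) * f (jump_place k (x, n)) \<partial>drives) = (K L ^^ k) f x"
  using f
proof (induction k arbitrary: f)
  case 0
  interpret prob_space drives by (intro prob_space_PiM prob_space_noise)
  show ?case by (simp add: emeasure_space_1)
next
  case (Suc k)
  interpret sequence_space "noise l" by (rule sequence_space_noise)
  define h where "h p = discount L (jump_time k (x, fst p)) *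
    (discount L (wait (jump_place k (x, fst p)) (snd p)) * f (target (jump_place k (x, fst p)) (snd p)))"
    for p :: "(nat \<Rightarrow> (nat \<Rightarrow> real) \<times> real) \<times> (nat \<Rightarrow> real) \<times> real"
  have xn[measurable]: "(\<lambda>p. (x, fst p)) \<in> drives \<Otimes>\<^sub>M noise l \<rightarrow>\<^sub>M borel_of M \<Otimes>\<^sub>M drives"
    using x by (intro measurable_Pair) auto
  have t[measurable]: "(\<lambda>p. jump_time k (x, fst p)) \<in> drives \<Otimes>\<^sub>M noise l \<rightarrow>\<^sub>M borel"
    and p[measurable]: "(\<lambda>p. jump_place k (x, fst p)) \<in> drives \<Otimes>\<^sub>M noise l \<rightarrow>\<^sub>M borel_of M"
    using measurable_compose[OF xn skeleton_measurable(1)[of k]]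
      measurable_compose[OF xn skeleton_measurable(2)[of k]] by simp_all
  have "(\<lambda>p. (jump_place k (x, fst p), snd p)) \<in> drives \<Otimes>\<^sub>M noise l \<rightarrow>\<^sub>M borel_of M \<Otimes>\<^sub>M noise l"
    by measurable
  note [measurable] = measurable_compose[OF this K_integrand_measurable[OF Suc.prems, of L], simplified]
  have h_meas: "h \<in> drives \<Otimes>\<^sub>M noise l \<rightarrow>\<^sub>M borel"
    unfolding h_def[abs_def] by measurable
  \<comment> \<open>If \<open>jump_time k\<close> is infinite, the place stays put while
    \<open>h\<close> uses \<open>target\<close>, but then both integrands are 0.\<close>
  have "(\<integral>\<^sup>+n. discount L (jump_time (Suc k) (x, n)) * f (jump_place (Suc k) (x, n)) \<partial>drives) =
      (\<integral>\<^sup>+n. h (n, n k) \<partial>drives)"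
    by (intro nn_integral_cong)
       (auto simp: h_def jump_time_Suc jump_place_Suc discount_add wait_nonneg skeleton_nonneg[OF one_le_l]
                   mult.assoc simp del: skeleton.simps)
  also have "\<dots> = (\<integral>\<^sup>+n. \<integral>\<^sup>+a. h (n, a) \<partial>noise l \<partial>drives)"
  proof (rule nn_integral_fresh_coordinate[OF h_meas])
    fix n n' :: "nat \<Rightarrow> (nat \<Rightarrow> real) \<times> real" and a :: "(nat \<Rightarrow> real) \<times> real"
    assume "\<And>i. i < k \<Longrightarrow> n i = n' i"
    then have "skeleton l \<phi> r G (x, n) k = skeleton l \<phi> r G (x, n') k" by (rule skeleton_past)
    then show "h (n, a) = h (n', a)" by (simp add: h_def)
  qed
  also have "\<dots> = (\<integral>\<^sup>+n. discount L (jump_time k (x, n)) * K L f (jump_place k (x, n)) \<partial>drives)"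
  proof (intro nn_integral_cong)
    fix n assume "n \<in> space drives"
    then have "jump_place k (x, n) \<in> M"
      using measurable_space[OF skeleton_measurable(2)[of k], of "(x, n)"] x by (simp add: space_pair_measure)
    then show "(\<integral>\<^sup>+a. h (n, a) \<partial>noise l) = discount L (jump_time k (x, n)) * K L f (jump_place k (x, n))"
      unfolding h_def K_def fst_conv snd_conv
      by (intro nn_integral_cmult measurable_K_integrand Suc.prems)
  qed
  also have "\<dots> = (K L ^^ Suc k) f x"
    using Suc.IH[OF K_measurable[OF Suc.prems]] by (simp add: funpow_swap1)
  finally show ?case .
qed

text \<open>A nonnegative function has integral 0 iff it vanishes almost everywhere; here it is the
  infimum of the discounts. Fubini separates the initial position from the noise, and monotone
  convergence exchanges infimum and integral.\<close>

lemma AE_no_explosion_iff: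
  assumes \<mu>: "\<mu> \<in> space (prob_algebra (borel_of M))" and L: "0 < L"
  shows "(AE \<omega> in driver l \<mu>. explosion_time (\<lambda>t. pdmp l \<phi> r G t \<omega>) = \<infinity>) \<longleftrightarrow>
    (\<integral>\<^sup>+x. (INF k. (K L ^^ k) (\<lambda>_. 1) x) \<partial>\<mu>) = 0"
proof -
  have sets_\<mu>[measurable_cong]: "sets \<mu> = sets (borel_of M)" and "prob_space \<mu>"
    using \<mu> by (auto simp: space_prob_algebra)
  have space_\<mu>: "space \<mu> = M" using sets_eq_imp_space_eq[OF sets_\<mu>] by simp
  interpret D: prob_space drives by (intro prob_space_PiM prob_space_noise)
  note nonneg = skeleton_nonneg[OF one_le_l, of \<phi> r G]
  let ?F = "\<lambda>\<omega>. INF k. discount L (jump_time k \<omega>)"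
  note [measurable] = skeleton_measurable(1)
  have F: "?F \<in> driver l \<mu> \<rightarrow>\<^sub>M borel" unfolding driver_def by measurable
  have x: "(\<lambda>n. jump_time k (x, n)) \<in> drives \<rightarrow>\<^sub>M borel" if "x \<in> M" for x k
    using measurable_compose[OF measurable_Pair1' skeleton_measurable(1)[of k], of x] that by simp
  have "(AE \<omega> in driver l \<mu>. explosion_time (\<lambda>t. pdmp l \<phi> r G t \<omega>) = \<infinity>) \<longleftrightarrow> (AE \<omega> in driver l \<mu>. ?F \<omega> = 0)"
    by (simp only: explosion_time_pdmp_eq_PInf INF_discount_eq_0_iff[OF L nonneg])
  also have "\<dots> \<longleftrightarrow> (\<integral>\<^sup>+\<omega>. ?F \<omega> \<partial>driver l \<mu>) = 0"
    using F by (simp only: nn_integral_0_iff_AE)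
  also have "(\<integral>\<^sup>+\<omega>. ?F \<omega> \<partial>driver l \<mu>) = (\<integral>\<^sup>+x. \<integral>\<^sup>+n. ?F (x, n) \<partial>drives \<partial>\<mu>)"
    using F unfolding driver_def by (rule D.nn_integral_fst[symmetric])
  also have "\<dots> = (\<integral>\<^sup>+x. (INF k. (K L ^^ k) (\<lambda>_. 1) x) \<partial>\<mu>)"
  proof (intro nn_integral_cong)
    fix x assume "x \<in> space \<mu>"
    then have xM: "x \<in> M" by (simp add: space_\<mu>)
    note [measurable] = x[OF xM]
    \<comment> \<open>Decreasing limits require one finite integral; at \<open>k = 0\<close> it
      equals 1.\<close>
    have "(\<integral>\<^sup>+n. ?F (x, n) \<partial>drives) = (INF k. \<integral>\<^sup>+n. discount L (jump_time k (x, n)) \<partial>drives)"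
    proof (rule nn_integral_monotone_convergence_INF_decseq[where i=0])
      show "decseq (\<lambda>k n. discount L (jump_time k (x, n)))"
        using L by (intro decseq_SucI le_funI discount_antimono nonneg skeleton_mono[OF one_le_l]) simp
      show "(\<integral>\<^sup>+ n. discount L (jump_time 0 (x, n)) \<partial>drives) < \<infinity>"
        by (simp add: D.emeasure_space_1)
    qed measurable
    also have "\<dots> = (INF k. (K L ^^ k) (\<lambda>_. 1) x)"
      using nn_integral_skeleton[OF xM, of "\<lambda>_. 1" L] by simp
    finally show "(\<integral>\<^sup>+n. ?F (x, n) \<partial>drives) = (INF k. (K L ^^ k) (\<lambda>_. 1) x)" .
  qed
  finally show ?thesis .
qed

lemma target_in: "x \<in> M \<Longrightarrow> n \<in> space (noise l) \<Longrightarrow> target x n \<in> M"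
  using measurable_space[OF target_measurable, of "(x, n)"] by (simp add: space_pair_measure)

text \<open>Both sides are expected discounts of successive jump times, and jump times
  increase.\<close>

lemma K_funpow_one_antimono:
  assumes x: "x \<in> M" and L: "0 < L"
  shows "(K L ^^ Suc k) (\<lambda>_. 1) x \<le> (K L ^^ k) (\<lambda>_. 1) x"
proof -
  have "(\<integral>\<^sup>+n. discount L (jump_time (Suc k) (x, n)) * 1 \<partial>drives) \<le>
      (\<integral>\<^sup>+n. discount L (jump_time k (x, n)) * 1 \<partial>drives)"
    by (intro nn_integral_mono mult_right_mono discount_antimono skeleton_nonneg skeleton_mono one_le_l less_imp_le[OF L]) simp
  then show ?thesis
    by (subst (asm) (1 2) nn_integral_skeleton[OF x]) (rule measurable_const, simp)+
qed

text \<open>The function \<open>w\<close> of the overview. For \<open>x\<close> in \<open>M\<close>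
  and \<open>L > 0\<close> it is the expected discount of the explosion time, hence positive exactly
  if explosion from \<open>x\<close> has positive probability.\<close>

definition explosion_weight :: "real \<Rightarrow> 'a \<Rightarrow> ennreal" where
  "explosion_weight L x = (INF k. (K L ^^ k) (\<lambda>_. 1) x)"

lemma explosion_weight_measurable: "explosion_weight L \<in> borel_of M \<rightarrow>\<^sub>M borel"
  unfolding explosion_weight_def[abs_def] by (intro borel_measurable_INF K_funpow_measurable) auto

lemma explosion_weight_le_one: "explosion_weight L x \<le> 1"
  unfolding explosion_weight_def by (rule INF_lower2[of 0]) auto

text \<open>The weight is below every iterate of index \<open>Suc k\<close>, that is, below
  \<open>K L\<close> applied to the iterate of index \<open>k\<close>. Monotone convergence takes
  the infimum over \<open>k\<close> inside the operator.\<close>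

lemma explosion_weight_le_K:
  assumes x: "x \<in> M" and L: "0 < L"
  shows "explosion_weight L x \<le> K L (explosion_weight L) x"
proof -
  interpret N: prob_space "noise l" by (rule prob_space_noise)
  let ?f = "\<lambda>k. (K L ^^ k) (\<lambda>_. 1)"
  have f: "?f k \<in> borel_of M \<rightarrow>\<^sub>M borel" for k by (rule K_funpow_measurable) simp
  have "explosion_weight L x \<le> (INF k. K L (?f k) x)"
    unfolding explosion_weight_def
  proof (rule INF_greatest)
    fix k
    have "(INF k. ?f k x) \<le> ?f (Suc k) x" by (rule INF_lower) simp
    then show "(INF k. ?f k x) \<le> K L (?f k) x" by simp
  qed
  also have "\<dots> = (\<integral>\<^sup>+n. (INF k. discount L (wait x n) * ?f k (target x n)) \<partial>noise l)"
    unfolding K_def[of L "?f _"]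
  proof (rule nn_integral_monotone_convergence_INF_AE[where i=0, symmetric])
    show "AE n in noise l. discount L (wait x n) * ?f (Suc k) (target x n) \<le> discount L (wait x n) * ?f k (target x n)" for k
      by (intro AE_I2 mult_left_mono K_funpow_one_antimono L target_in x) auto
    show "(\<lambda>n. discount L (wait x n) * ?f k (target x n)) \<in> noise l \<rightarrow>\<^sub>M borel" for k
      by (rule measurable_K_integrand[OF f x])
    have "(\<integral>\<^sup>+n. discount L (wait x n) * ?f 0 (target x n) \<partial>noise l) \<le> (\<integral>\<^sup>+n. 1 \<partial>noise l)"
      using L by (intro nn_integral_mono) (simp add: discount_le_one wait_nonneg)
    also have "\<dots> < \<infinity>" by (simp add: N.emeasure_space_1)
    finally show "(\<integral>\<^sup>+n. discount L (wait x n) * ?f 0 (target x n) \<partial>noise l) < \<infinity>" .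
  qed
  also have "\<dots> = K L (explosion_weight L) x"
    unfolding K_def[of L "explosion_weight L"] explosion_weight_def
    by (intro nn_integral_cong INF_ennreal_cmult) (auto simp: discount_def)
  finally show ?thesis .
qed

end

section \<open>Adding a bounded jump rate\<close>

text \<open>Here \<open>y\<close> is the exponential variable of the last mechanism and
  \<open>s\<close> the first jump time of the others. The first branch is the discount at
  \<open>y / L\<close>, the earliest possible ring; the second is half the discount at
  \<open>s\<close>.\<close>

definition race :: "real \<Rightarrow> ereal \<Rightarrow> real \<Rightarrow> ennreal" where
  "race L s y = (if ereal y < ereal L * s then ennreal (exp (- y)) else discount L s * ennreal (1/2))"

lemma nn_integral_exp_atLeast:
  assumes "0 < c"
  shows "(\<integral>\<^sup>+y. ennreal (exp (- c * y)) * indicator {a..} y \<partial>lborel) = ennreal (exp (- c * a) / c)"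
proof -
  have lim: "((\<lambda>y. - (exp (- c * y) / c)) \<longlongrightarrow> - (0 / c)) at_top"
  proof -
    have "((\<lambda>y. exp (- c * y)) \<longlongrightarrow> 0) at_top" using assms by real_asymp
    then show ?thesis using assms by (intro tendsto_intros) auto
  qed
  have "(\<integral>\<^sup>+y. ennreal (exp (- c * y)) * indicator {a..} y \<partial>lborel) =
      ennreal (- (0 / c) - (- (exp (- c * a) / c)))"
    using assms lim by (intro nn_integral_FTC_atLeast) (auto intro!: derivative_eq_intros)
  then show ?thesis by simp
qed

text \<open>With \<open>b = L * s\<close>, the part below \<open>b\<close> gives
  \<open>(1 - exp (- 2 * b)) / 2\<close> and the part above gives \<open>exp (- 2 * b) / 2\<close>.
  The factor 1/2 in \<open>race\<close> is the one for which the dependence on \<open>s\<close>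
  cancels.\<close>

lemma nn_integral_race:
  assumes L: "0 < L" and s: "0 \<le> s"
  shows "(\<integral>\<^sup>+y. race L s y \<partial>density lborel (exponential_density 1)) \<le> ennreal (1/2)"
proof -
  have [measurable]: "race L s \<in> borel \<rightarrow>\<^sub>M borel" unfolding race_def[abs_def] by measurable
  have *: "(\<integral>\<^sup>+y. race L s y \<partial>density lborel (exponential_density 1)) =
      (\<integral>\<^sup>+y. ennreal (exponential_density 1 y) * race L s y \<partial>lborel)"
    by (subst nn_integral_density) auto
  show ?thesis
  proof (cases s)
    case PInf
    have "(\<integral>\<^sup>+y. ennreal (exponential_density 1 y) * race L s y \<partial>lborel) =
        (\<integral>\<^sup>+y. ennreal (exp (- 2 * y)) * indicator {0..} y \<partial>lborel)"
      using L PInf by (intro nn_integral_cong)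
        (auto simp: race_def exponential_density_def indicator_def ennreal_mult[symmetric] exp_add[symmetric])
    then show ?thesis unfolding * nn_integral_exp_atLeast[OF zero_less_numeral] by simp
  next
    case (real t)
    define b where "b = L * t"
    have b: "0 \<le> b" using L s real by (simp add: b_def)
    \<comment> \<open>The two indicators overlap at \<open>y = b\<close>, which is why the
      integrands are compared by an inequality.\<close>
    have "(\<integral>\<^sup>+y. ennreal (exponential_density 1 y) * race L s y \<partial>lborel) \<le>
        (\<integral>\<^sup>+y. ennreal (exp (- 2 * y)) * indicator {0..b} y +
              ennreal (exp (- b) / 2) * (ennreal (exp (- 1 * y)) * indicator {b..} y) \<partial>lborel)"
    proof (rule nn_integral_mono)
      fix y
      have half: "ennreal (exp (- b)) * ennreal (1/2) = ennreal (exp (- b) / 2)"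
        by (subst ennreal_mult[symmetric]) auto
      consider "y < 0" | "0 \<le> y" "y < b" | "b \<le> y" "0 \<le> y" using b by linarith
      then show "ennreal (exponential_density 1 y) * race L s y \<le>
          ennreal (exp (- 2 * y)) * indicator {0..b} y +
          ennreal (exp (- b) / 2) * (ennreal (exp (- 1 * y)) * indicator {b..} y)"
      proof cases
        case 2
        then have "ennreal (exponential_density 1 y) * race L s y = ennreal (exp (- 2 * y))"
          using real by (simp add: race_def exponential_density_def b_def ennreal_mult[symmetric] exp_add[symmetric])
        then show ?thesis using 2 by simp
      next
        case 3
        then have "race L s y = ennreal (exp (- b) / 2)"
          using real half by (simp only: race_def b_def discount_simps times_ereal.simps less_ereal.simps) simp
        then show ?thesis using 3 by (simp add: exponential_density_def mult.commute)
      qed (simp add: exponential_density_def)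
    qed
    also have "\<dots> = (\<integral>\<^sup>+y. ennreal (exp (- 2 * y)) * indicator {0..b} y \<partial>lborel) +
        ennreal (exp (- b) / 2) * (\<integral>\<^sup>+y. ennreal (exp (- 1 * y)) * indicator {b..} y \<partial>lborel)"
      by (simp add: nn_integral_add nn_integral_cmult)
    also have "(\<integral>\<^sup>+y. ennreal (exp (- 2 * y)) * indicator {0..b} y \<partial>lborel) =
        ennreal (- (exp (- 2 * b) / 2) - (- (exp (- 2 * 0) / 2)))"
      using b by (intro nn_integral_FTC_Icc) (auto intro!: derivative_eq_intros)
    also have "(\<integral>\<^sup>+y. ennreal (exp (- 1 * y)) * indicator {b..} y \<partial>lborel) = ennreal (exp (- b))"
      using nn_integral_exp_atLeast[of 1 b] by simp
    also have "ennreal (- (exp (- 2 * b) / 2) - (- (exp (- 2 * 0) / 2))) +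
        ennreal (exp (- b) / 2) * ennreal (exp (- b)) = ennreal (1/2)"
      using b by (simp add: ennreal_mult[symmetric] exp_add[symmetric] ennreal_plus[symmetric] del: ennreal_plus)
    finally show ?thesis unfolding * .
  qed (use s in auto)
qed

text \<open>Integrating the last exponential variable innermost freezes the remaining noise, and
  with it the first jump of the smaller process, while \<open>y\<close> varies.\<close>

lemma nn_integral_noise_Suc:
  assumes F: "F \<in> noise (Suc m) \<rightarrow>\<^sub>M borel"
  shows "integral\<^sup>N (noise (Suc m)) F =
    (\<integral>\<^sup>+n. \<integral>\<^sup>+y. F ((fst n)(Suc m := y), snd n) \<partial>density lborel (exponential_density 1) \<partial>noise m)"
proof -
  let ?E = "density lborel (exponential_density 1)" and ?U = uniform01
  let ?P = "\<lambda>J. \<Pi>\<^sub>M j\<in>J. ?E"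
  interpret E: prob_space ?E by (rule prob_space_exponential1)
  interpret U: prob_space ?U by (rule prob_space_uniform01)
  interpret EU: pair_sigma_finite ?E ?U ..
  interpret prod: product_sigma_finite "\<lambda>_::nat. ?E" ..
  have I: "{1..Suc m} = insert (Suc m) {1..m}" by auto
  have F'[measurable]: "F \<in> ?P (insert (Suc m) {1..m}) \<Otimes>\<^sub>M ?U \<rightarrow>\<^sub>M borel"
    using F unfolding noise_def I .
  have "integral\<^sup>N (noise (Suc m)) F = (\<integral>\<^sup>+e. \<integral>\<^sup>+u. F (e, u) \<partial>?U \<partial>?P (insert (Suc m) {1..m}))"
    using F' unfolding noise_def I by (rule U.nn_integral_fst[symmetric])
  also have "\<dots> = (\<integral>\<^sup>+e. \<integral>\<^sup>+y. \<integral>\<^sup>+u. F (e(Suc m := y), u) \<partial>?U \<partial>?E \<partial>?P {1..m})"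
    by (rule prod.product_nn_integral_insert[OF _ _ U.borel_measurable_nn_integral_fst[OF F']]) auto
  \<comment> \<open>The product rule leaves \<open>y\<close> outside the uniform variable; Fubini
    moves it inside.\<close>
  also have "\<dots> = (\<integral>\<^sup>+e. \<integral>\<^sup>+u. \<integral>\<^sup>+y. F (e(Suc m := y), u) \<partial>?E \<partial>?U \<partial>?P {1..m})"
  proof (intro nn_integral_cong)
    fix e assume e: "e \<in> space (?P {1..m})"
    have [measurable]: "(\<lambda>p. (e(Suc m := fst p), snd p)) \<in> ?E \<Otimes>\<^sub>M ?U \<rightarrow>\<^sub>M ?P (insert (Suc m) {1..m}) \<Otimes>\<^sub>M ?U"
      using e by (intro measurable_Pair measurable_fun_upd[where J="{1..m}"]) auto
    show "(\<integral>\<^sup>+y. \<integral>\<^sup>+u. F (e(Suc m := y), u) \<partial>?U \<partial>?E) = (\<integral>\<^sup>+u. \<integral>\<^sup>+y. F (e(Suc m := y), u) \<partial>?E \<partial>?U)"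
      using measurable_compose[OF _ F', of "\<lambda>p. (e(Suc m := fst p), snd p)" "?E \<Otimes>\<^sub>M ?U"]
      by (intro EU.Fubini'[symmetric]) (auto simp: case_prod_beta)
  qed
  also have "\<dots> = (\<integral>\<^sup>+n. \<integral>\<^sup>+y. F ((fst n)(Suc m := y), snd n) \<partial>?E \<partial>noise m)"
  proof -
    have "(\<lambda>p. ((fst (fst p))(Suc m := snd p), snd (fst p))) \<in>
        (?P {1..m} \<Otimes>\<^sub>M ?U) \<Otimes>\<^sub>M ?E \<rightarrow>\<^sub>M ?P (insert (Suc m) {1..m}) \<Otimes>\<^sub>M ?U"
      by (intro measurable_Pair measurable_fun_upd[where J="{1..m}"]) auto
    from measurable_compose[OF this F']
    have "(\<lambda>n. \<integral>\<^sup>+y. F ((fst n)(Suc m := y), snd n) \<partial>?E) \<in> ?P {1..m} \<Otimes>\<^sub>M ?U \<rightarrow>\<^sub>M borel"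
      by (intro E.borel_measurable_nn_integral) (simp add: case_prod_beta)
    from U.nn_integral_fst[OF this] show ?thesis unfolding noise_def by simp
  qed
  finally show ?thesis .
qed

lemma first_time_cong: "(\<And>j. j \<in> {1..l} \<Longrightarrow> T j = T' j) \<Longrightarrow> first_time l T = first_time l T'"
  unfolding first_time_def by (intro arg_cong[where f=Min] image_cong) auto

lemma first_index_cong:
  assumes "\<And>j. j \<in> {1..l} \<Longrightarrow> T j = T' j"
  shows "first_index l T = first_index l T'"
proof -
  have "{j. j \<in> {1..l} \<and> T j = first_time l T} = {j. j \<in> {1..l} \<and> T' j = first_time l T'}"
    using assms first_time_cong[of l T T'] by auto
  then show ?thesis unfolding first_index_def by simp
qed

section \<open>Comparison of the processes with and without the last mechanism\<close>

locale bounded_extra_rate =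
  big: pdmp_model M "Suc m" \<phi> r Q G + small: pdmp_model M m \<phi> r Q G
  for M :: "'a::euclidean_space set" and m \<phi> r Q G +
  fixes L :: real
  assumes L_pos: "0 < L" and rate_le: "\<And>x. x \<in> M \<Longrightarrow> r (Suc m) x \<le> L"
begin

text \<open>A pathwise comparison. If the last clock does not ring strictly first, both processes
  make the same jump and the bound by \<open>g\<close> applies. Otherwise the jump comes no earlier
  than \<open>y / L\<close> and the bound by \<open>a\<close> applies.\<close>

lemma one_step_le:
  assumes x: "x \<in> M"
    and target: "big.target x (e(Suc m := y), u) \<in> M"
    and le_a: "\<And>x. x \<in> M \<Longrightarrow> v x \<le> a"
    and le_g: "\<And>x. x \<in> M \<Longrightarrow> v x \<le> g x + a * ennreal (1/2)"
  shows "discount L (big.wait x (e(Suc m := y), u)) * v (big.target x (e(Suc m := y), u))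
    \<le> discount L (small.wait x (e, u)) * g (small.target x (e, u)) + a * race L (small.wait x (e, u)) y"
proof -
  define s where "s = small.wait x (e, u)"
  define T where "T = clocks \<phi> r x (e(Suc m := y))"
  have s0: "0 \<le> s" unfolding s_def by (rule small.wait_nonneg)
  have cl: "T j = clocks \<phi> r x e j" if "j \<in> {1..m}" for j
    using that by (auto simp: T_def clocks_def)
  have s: "s = first_time m T"
    unfolding s_def small.wait_def fst_conv by (rule first_time_cong) (simp add: cl)
  have late: "ereal (y / L) \<le> T (Suc m)"
    using big.jump_clock_ge[of "Suc m" x L y] x L_pos rate_le by (auto simp: T_def clocks_def)
  have w: "big.wait x (e(Suc m := y), u) = min (T (Suc m)) s"
    unfolding big.wait_def s fst_conv T_def[symmetric] by (rule first_time_Suc[OF small.one_le_l])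
  show ?thesis
  proof (cases "s \<le> T (Suc m)")
    case True
    have idx: "first_index (Suc m) T = first_index m (clocks \<phi> r x e)"
      using first_index_Suc[OF small.one_le_l, of T] True s first_index_cong[of m T, OF cl] by simp
    have w': "big.wait x (e(Suc m := y), u) = s" using w True by (simp add: min_absorb2)
    have t: "big.target x (e(Suc m := y), u) = small.target x (e, u)"
      unfolding big.target_def small.target_def w' s_def[symmetric] fst_conv snd_conv T_def[symmetric] idx ..
    \<comment> \<open>\<open>y < L * s\<close> is still possible here, because \<open>y / L\<close>
      only bounds the last clock from below; the first branch of \<open>race\<close> is then even
      larger.\<close>
    have "discount L s * ennreal (1/2) \<le> race L s y"
    proof (cases "ereal y < ereal L * s")
      case True
      have "ennreal (1/2) \<le> 1" using ennreal_leI[of "1/2" 1] by simp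
      then have "discount L s * ennreal (1/2) \<le> discount L s * 1" by (intro mult_left_mono) auto
      also have "\<dots> \<le> ennreal (exp (- y))"
        using True L_pos s0 by (cases s) (auto intro!: ennreal_leI)
      finally show ?thesis using True by (simp add: race_def)
    qed (simp add: race_def)
    then have "a * (discount L s * ennreal (1/2)) \<le> a * race L s y" by (rule mult_left_mono) simp
    moreover have "discount L s * v (small.target x (e, u)) \<le>
        discount L s * (g (small.target x (e, u)) + a * ennreal (1/2))"
      using le_g target unfolding t by (intro mult_left_mono) auto
    ultimately show ?thesis
      unfolding w' t s_def[symmetric]
      by (auto simp: distrib_left mult.left_commute intro: order_trans add_left_mono)
  next
    case False
    \<comment> \<open>The last clock rings between \<open>y / L\<close> and \<open>s\<close>, so
      \<open>race\<close> is in its first branch, which dominates the discount at the ring.\<close>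
    then have "ereal (y / L) < s" using late by auto
    then have lt: "ereal y < ereal L * s" using L_pos by (cases s) (auto simp: field_simps)
    have "discount L (T (Suc m)) \<le> ennreal (exp (- y))"
    proof (cases "T (Suc m)")
      case (real t)
      then show ?thesis using late L_pos by (auto simp: field_simps intro!: ennreal_leI)
    qed (use late in auto)
    then have "discount L (T (Suc m)) * v (big.target x (e(Suc m := y), u)) \<le> ennreal (exp (- y)) * a"
      using le_a[OF target] by (intro mult_mono) auto
    also have "\<dots> = a * race L s y" using lt by (simp add: race_def mult.commute)
    also have "\<dots> \<le> discount L s * g (small.target x (e, u)) + a * race L s y" by simp
    finally show ?thesis using w False unfolding s_def[symmetric] by (simp add: min_absorb1)
  qed
qed

lemma K_le:
  assumes x: "x \<in> M" and v: "v \<in> borel_of M \<rightarrow>\<^sub>M borel" and g: "g \<in> borel_of M \<rightarrow>\<^sub>M borel"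
    and le_a: "\<And>x. x \<in> M \<Longrightarrow> v x \<le> a"
    and le_g: "\<And>x. x \<in> M \<Longrightarrow> v x \<le> g x + a * ennreal (1/2)"
  shows "big.K L v x \<le> small.K L g x + a * ennreal (1/2)"
proof -
  let ?E = "density lborel (exponential_density 1)"
  interpret E: prob_space ?E by (rule prob_space_exponential1)
  interpret N: prob_space "noise m" by (rule prob_space_noise)
  let ?D = "\<lambda>n. discount L (small.wait x n) * g (small.target x n)"
  have D[measurable]: "?D \<in> noise m \<rightarrow>\<^sub>M borel" by (rule small.measurable_K_integrand[OF g x])
  have race[measurable]: "race L s \<in> borel \<rightarrow>\<^sub>M borel" for s unfolding race_def[abs_def] by measurable
  have "big.K L v x = (\<integral>\<^sup>+n. \<integral>\<^sup>+y. discount L (big.wait x ((fst n)(Suc m := y), snd n)) *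
      v (big.target x ((fst n)(Suc m := y), snd n)) \<partial>?E \<partial>noise m)"
    unfolding big.K_def by (subst nn_integral_noise_Suc[OF big.measurable_K_integrand[OF v x]]) simp
  also have "\<dots> \<le> (\<integral>\<^sup>+n. \<integral>\<^sup>+y. ?D n + a * race L (small.wait x n) y \<partial>?E \<partial>noise m)"
  proof (intro nn_integral_mono)
    fix n y assume n: "n \<in> space (noise m)"
    \<comment> \<open>The bounds on \<open>v\<close> hold only on \<open>M\<close>. The updated
      noise is a point of the larger noise space, so the target does lie in
      \<open>M\<close>.\<close>
    have "(fst n)(Suc m := y) \<in> space (\<Pi>\<^sub>M j\<in>{1..Suc m}. borel)"
      using n by (auto simp: noise_def space_pair_measure space_PiM PiE_def extensional_def)
    then have "((fst n)(Suc m := y), snd n) \<in> space (noise (Suc m))"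
      using n by (auto simp: noise_def space_pair_measure space_PiM)
    then have "big.target x ((fst n)(Suc m := y), snd n) \<in> M"
      using measurable_space[OF big.target_measurable, of "(x, ((fst n)(Suc m := y), snd n))"] x
      by (simp add: space_pair_measure)
    from one_step_le[OF x this le_a le_g]
    show "discount L (big.wait x ((fst n)(Suc m := y), snd n)) * v (big.target x ((fst n)(Suc m := y), snd n))
      \<le> ?D n + a * race L (small.wait x n) y" by simp
  qed
  also have "\<dots> = (\<integral>\<^sup>+n. ?D n + a * (\<integral>\<^sup>+y. race L (small.wait x n) y \<partial>?E) \<partial>noise m)"
    using E.emeasure_space_1
    by (intro nn_integral_cong) (simp add: nn_integral_add nn_integral_cmult)
  also have "\<dots> \<le> (\<integral>\<^sup>+n. ?D n + a * ennreal (1/2) \<partial>noise m)"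
    by (intro nn_integral_mono add_left_mono mult_left_mono nn_integral_race L_pos small.wait_nonneg) simp
  also have "\<dots> = small.K L g x + a * ennreal (1/2)"
    using N.emeasure_space_1 by (simp add: nn_integral_add small.K_def)
  finally show ?thesis .
qed

text \<open>The error \<open>a/2\<close> does not accumulate along the induction: each use of
  \<open>K_le\<close> applies the bound by \<open>a\<close> afresh and returns the same
  \<open>a/2\<close>.\<close>

lemma explosion_weight_halved:
  assumes small: "\<And>x. x \<in> M \<Longrightarrow> small.explosion_weight L x = 0"
    and a: "\<And>x. x \<in> M \<Longrightarrow> big.explosion_weight L x \<le> a" and x: "x \<in> M"
  shows "big.explosion_weight L x \<le> a * ennreal (1/2)"
proof -
  let ?w = "big.explosion_weight L" and ?g = "\<lambda>k. (small.K L ^^ k) (\<lambda>_. 1)"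
  have "?w x \<le> ?g k x + a * ennreal (1/2)" if "x \<in> M" for k x
    using that
  proof (induction k arbitrary: x)
    case 0
    show ?case using big.explosion_weight_le_one[of L x] by (simp add: add_increasing2)
  next
    case (Suc k)
    have "?w x \<le> big.K L ?w x" by (rule big.explosion_weight_le_K[OF Suc.prems L_pos])
    also have "\<dots> \<le> small.K L (?g k) x + a * ennreal (1/2)"
      by (intro K_le Suc big.explosion_weight_measurable small.K_funpow_measurable a) auto
    finally show ?case by simp
  qed
  then have "?w x \<le> (INF k. ?g k x + a * ennreal (1/2))" using x by (intro INF_greatest) auto
  also have "\<dots> = small.explosion_weight L x + a * ennreal (1/2)"
    unfolding small.explosion_weight_def by (rule INF_ennreal_add_const)
  finally show ?thesis using small[OF x] by simp
qed

text \<open>Halving from the bound 1 gives \<open>(1/2) ^ n\<close>. The induction runs over all of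
  \<open>M\<close> at once, as each halving starts from a uniform bound.\<close>

lemma explosion_weight_eq_0:
  assumes small: "\<And>x. x \<in> M \<Longrightarrow> small.explosion_weight L x = 0" and x: "x \<in> M"
  shows "big.explosion_weight L x = 0"
proof -
  have le: "big.explosion_weight L x \<le> ennreal ((1/2) ^ n)" if "x \<in> M" for n x
    using that
  proof (induction n arbitrary: x)
    case (Suc n)
    have "big.explosion_weight L x \<le> ennreal ((1/2) ^ n) * ennreal (1/2)"
      by (rule explosion_weight_halved[OF small Suc.IH Suc.prems])
    also have "\<dots> = ennreal ((1/2) ^ Suc n)"
      by (subst ennreal_mult[symmetric]) (auto simp: mult.commute)
    finally show ?case .
  qed (simp add: big.explosion_weight_le_one)
  have "(\<lambda>n. ennreal ((1/2) ^ n)) \<longlonglongrightarrow> ennreal 0"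
    by (intro tendsto_ennrealI LIMSEQ_realpow_zero) auto
  then have "big.explosion_weight L x \<le> ennreal 0"
    by (rule LIMSEQ_le_const) (use le[OF x] in blast)
  then show ?thesis by simp
qed

end

section \<open>Conclusion for arbitrary initial distributions\<close>

theorem proposition9:
  fixes M :: "'a::euclidean_space set" and d l :: nat
    and \<phi> :: "real \<Rightarrow> 'a \<Rightarrow> 'a"
    and lam :: "nat \<Rightarrow> 'a \<Rightarrow> real"
    and Q :: "nat \<Rightarrow> 'a \<Rightarrow> 'a measure"
  assumes "smooth_submanifold d M" and "closed M"
    and "l > 1"
    and "pdmp_characteristics M l \<phi> lam Q"
    and "non_explosive M (l - 1) \<phi> lam Q"
    and "(SUP x\<in>M. ereal \<bar>lam l x\<bar>) < \<infinity>"
  shows "non_explosive M l \<phi> lam Q"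
  unfolding non_explosive_def
proof (intro ballI allI impI)
  fix \<mu> G assume \<mu>: "\<mu> \<in> space (prob_algebra (borel_of M))" and G: "represents_kernels M l Q G"
  obtain m where l: "l = Suc m" and m: "1 \<le> m" using \<open>l > 1\<close> by (cases l) auto
  obtain B where B: "\<And>x. x \<in> M \<Longrightarrow> ereal \<bar>lam l x\<bar> \<le> ereal B"
  proof (cases "SUP x\<in>M. ereal \<bar>lam l x\<bar>")
    case (real b)
    then have "\<And>x. x \<in> M \<Longrightarrow> ereal \<bar>lam l x\<bar> \<le> ereal b" by (metis SUP_upper)
    then show ?thesis by (rule that)
  next
    \<comment> \<open>The supremum is \<open>- \<infinity>\<close> only for empty \<open>M\<close>,
      where any bound serves.\<close>
    case MInf
    have "ereal \<bar>lam l x\<bar> \<le> ereal 0" if "x \<in> M" for x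
      using SUP_upper[OF that, of "\<lambda>x. ereal \<bar>lam l x\<bar>"] unfolding MInf by simp
    then show ?thesis by (rule that)
  qed (use assms(6) in simp)
  \<comment> \<open>The maximum with 1 keeps \<open>L\<close> positive even if the last rate
    vanishes identically.\<close>
  define L where "L = max 1 B"
  have G': "represents_kernels M m Q G"
    using G unfolding represents_kernels_def l by auto
  have char': "pdmp_characteristics M m \<phi> lam Q"
    using assms(4) unfolding pdmp_characteristics_def l by auto
  interpret bounded_extra_rate M m \<phi> lam Q G L
  proof unfold_locales
    show "lam (Suc m) x \<le> L" if "x \<in> M" for x
      using B[OF that] unfolding L_def l by simp
  qed (use assms(4) G G' char' m in \<open>auto simp: l L_def\<close>)
  \<comment> \<open>Starting the smaller process from a point mass turns almost sure non-explosion
    into a statement at every single point, as the comparison requires.\<close>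
  have small_0: "small.explosion_weight L x = 0" if x: "x \<in> M" for x
  proof -
    have ret: "return (borel_of M) x \<in> space (prob_algebra (borel_of M))"
      using x by (auto simp: space_prob_algebra intro!: prob_space_return)
    have "AE \<omega> in driver m (return (borel_of M) x). explosion_time (\<lambda>t. pdmp m \<phi> lam G t \<omega>) = \<infinity>"
      using assms(5) ret G' unfolding non_explosive_def l diff_Suc_1 by blast
    then have "(\<integral>\<^sup>+y. small.explosion_weight L y \<partial>return (borel_of M) x) = 0"
      unfolding small.AE_no_explosion_iff[OF ret L_pos] small.explosion_weight_def .
    then show ?thesis
      using x by (subst (asm) nn_integral_return) (auto simp: small.explosion_weight_measurable)
  qed
  have space: "space \<mu> = M"
    using \<mu> sets_eq_imp_space_eq[of \<mu> "borel_of M"] by (simp add: space_prob_algebra)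
  have "(\<integral>\<^sup>+x. big.explosion_weight L x \<partial>\<mu>) = (\<integral>\<^sup>+x. 0 \<partial>\<mu>)"
    using explosion_weight_eq_0[OF small_0] by (intro nn_integral_cong) (simp add: space)
  then show "AE \<omega> in driver l \<mu>. explosion_time (\<lambda>t. pdmp l \<phi> lam G t \<omega>) = \<infinity>"
    unfolding l big.AE_no_explosion_iff[OF \<mu> L_pos] big.explosion_weight_def by simp
qed

end
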